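(* If $D$ is a point-determining digraph with at least one vertex, then there exists a vertex $v\in V(D)$ such that $D-v$ is point-determining.
   Context: Digraphs are finite, without loops and multiple arcs. For distinct vertices $u,v,w$ of a digraph $D$, $w$ distinguishes $u,v$ if exactly one of $u,v$ is an in-neighbour of $w$, or exactly one of $u,v$ is an out-neighbour of $w$. Distinct vertices $u,v$ are twins in $D$ if no vertex of $D$ distinguishes them; they are false twins if moreover neither $(u,v)$ nor $(v,u)$ is an arc. $D$ is point-determining if it contains no pair of false twins. *)

theory Defs
  imports "Graph_Theory.Digraph"
begin

text \<open>The inequality of two truth values below says that exactly one of them holds.\<close>

definition distinguishes :: "('a, 'b) pre_digraph \<Rightarrow> 'a \<Rightarrow> 'a \<Rightarrow> 'a \<Rightarrow> bool" where
  "distinguishes D w u v \<longleftrightarrow>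
     u \<in> verts D \<and> v \<in> verts D \<and> w \<in> verts D \<and> distinct [u, v, w] \<and>
     ((u \<rightarrow>\<^bsub>D\<^esub> w) \<noteq> (v \<rightarrow>\<^bsub>D\<^esub> w) \<or> (w \<rightarrow>\<^bsub>D\<^esub> u) \<noteq> (w \<rightarrow>\<^bsub>D\<^esub> v))"

definition twins :: "('a, 'b) pre_digraph \<Rightarrow> 'a \<Rightarrow> 'a \<Rightarrow> bool" where
  "twins D u v \<longleftrightarrow>
     u \<in> verts D \<and> v \<in> verts D \<and> u \<noteq> v \<and> \<not> (\<exists>w \<in> verts D. distinguishes D w u v)"

definition false_twins :: "('a, 'b) pre_digraph \<Rightarrow> 'a \<Rightarrow> 'a \<Rightarrow> bool" where
  "false_twins D u v \<longleftrightarrow> twins D u v \<and> \<not> (u \<rightarrow>\<^bsub>D\<^esub> v) \<and> \<not> (v \<rightarrow>\<^bsub>D\<^esub> u)"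

definition point_determining :: "('a, 'b) pre_digraph \<Rightarrow> bool" where
  "point_determining D \<longleftrightarrow> \<not> (\<exists>u \<in> verts D. \<exists>v \<in> verts D. false_twins D u v)"

end

theory Submission
  imports Defs "HOL-Library.FuncSet"
begin

text \<open>
  If no vertex \<open>w\<close> can be deleted, then every \<open>w\<close> is the only vertex that separates the
  neighbourhoods of some pair \<open>u\<close>, \<open>v\<close>. Following the proof of Bondy's theorem on induced subsets,
  restrict all neighbourhoods to a growing set \<open>S\<close> of vertices: each vertex added to \<open>S\<close> splits a
  class of equal restrictions. There is one class for empty \<open>S\<close>, so there are more classes than
  vertices in the end, which is absurd.
\<close>

lemma card_less_if_all_coordinates_critical:
  fixes f :: "'a \<Rightarrow> 'b \<Rightarrow> 'c"
  assumes "finite V" "V \<noteq> {}" "finite X"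
    and critical: "\<And>w. w \<in> X \<Longrightarrow>
      \<exists>u \<in> V. \<exists>v \<in> V. f u w \<noteq> f v w \<and> (\<forall>x \<in> X - {w}. f u x = f v x)"
  shows "card X < card V"
proof -
  have "card X < card ((\<lambda>v. restrict (f v) X) ` V)"
    using \<open>finite X\<close> subset_refl
  proof (induction rule: finite_subset_induct')
    case empty
    show ?case
      using assms(1,2) by (simp add: card_gt_0_iff)
  next
    case (insert w S)
    let ?A = "(\<lambda>v. restrict (f v) (insert w S)) ` V"
    obtain u v where uv: "u \<in> V" "v \<in> V" "f u w \<noteq> f v w"
      "\<And>x. x \<in> X - {w} \<Longrightarrow> f u x = f v x"
      using critical[OF \<open>w \<in> X\<close>] by blast
    \<comment> \<open>Forgetting the coordinate \<open>w\<close> maps the classes for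
      \<open>insert w S\<close> onto those for \<open>S\<close>. This surjection merges the classes
      of \<open>u\<close> and \<open>v\<close>, so it strictly lowers the number of classes.\<close>
    have image: "(\<lambda>v. restrict (f v) S) ` V = (\<lambda>g. restrict g S) ` ?A"
      by (simp add: image_image Int_absorb1 subset_insertI)
    \<comment> \<open>Since \<open>w\<close> is not in \<open>S\<close>, the set \<open>S\<close>
      lies in \<open>X - {w}\<close>, where \<open>u\<close> and \<open>v\<close> agree.\<close>
    have eq: "restrict (restrict (f u) (insert w S)) S = restrict (restrict (f v) (insert w S)) S"
      using uv(4) insert.hyps by (auto simp: restrict_def fun_eq_iff)
    have neq: "restrict (f u) (insert w S) \<noteq> restrict (f v) (insert w S)"
      using uv(3) by (metis insertI1 restrict_apply')
    have mem: "restrict (f u) (insert w S) \<in> ?A" "restrict (f v) (insert w S) \<in> ?A"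
      using uv(1,2) by simp_all
    have "\<not> inj_on (\<lambda>g. restrict g S) ?A"
      using neq inj_onD[OF _ eq mem] by metis
    then have "card ((\<lambda>v. restrict (f v) S) ` V) < card ?A"
      unfolding image using \<open>finite V\<close>
      by (meson card_image_le eq_card_imp_inj_on finite_imageI le_neq_implies_less)
    with insert.IH insert.hyps show ?case
      by (metis Suc_leI card_insert_disjoint order_le_less_trans)
  qed
  also have "\<dots> \<le> card V"
    using \<open>finite V\<close> by (rule card_image_le)
  finally show ?thesis .
qed

definition neighbourhood :: "('a, 'b) pre_digraph \<Rightarrow> 'a \<Rightarrow> 'a \<Rightarrow> bool \<times> bool" where
  "neighbourhood D v w = (v \<rightarrow>\<^bsub>D\<^esub> w, w \<rightarrow>\<^bsub>D\<^esub> v)"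

lemma dominates_del_vert_iff:
  "u \<rightarrow>\<^bsub>pre_digraph.del_vert D w\<^esub> v \<longleftrightarrow> u \<rightarrow>\<^bsub>D\<^esub> v \<and> u \<noteq> w \<and> v \<noteq> w"
  by (auto simp: arcs_ends_def arc_to_ends_def pre_digraph.del_vert_def)

text \<open>\<open>distinguishes\<close> skips the coordinates \<open>u\<close> and
  \<open>v\<close>. Without loops, agreement at either of them says exactly that no arc joins
  \<open>u\<close> and \<open>v\<close>, so non-adjacency becomes part of having equal
  neighbourhoods.\<close>

lemma false_twins_iff:
  assumes "\<And>x. \<not> x \<rightarrow>\<^bsub>D\<^esub> x"
  shows "false_twins D u v \<longleftrightarrow>
    u \<in> verts D \<and> v \<in> verts D \<and> u \<noteq> v \<and> (\<forall>w \<in> verts D. neighbourhood D u w = neighbourhood D v w)"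
  unfolding false_twins_def twins_def distinguishes_def neighbourhood_def
  using assms by auto

theorem theorem1:
  fixes D :: "('a, 'b) pre_digraph"
  assumes "digraph D"
    and "verts D \<noteq> {}"
    and "point_determining D"
  shows "\<exists>v \<in> verts D. point_determining (pre_digraph.del_vert D v)"
proof (rule ccontr)
  assume no_deletion: "\<not> ?thesis"
  interpret digraph D by fact
  have loopfree: "\<not> x \<rightarrow>\<^bsub>D\<^esub> x" for x
    using adj_not_same by blast
  have critical: "\<exists>u \<in> verts D. \<exists>v \<in> verts D. neighbourhood D u w \<noteq> neighbourhood D v w \<and>
      (\<forall>x \<in> verts D - {w}. neighbourhood D u x = neighbourhood D v x)"
    if "w \<in> verts D" for w
  proof -
    have loopfree_del: "\<not> x \<rightarrow>\<^bsub>del_vert w\<^esub> x" for x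
      using loopfree by (simp add: dominates_del_vert_iff)
    obtain u v where "false_twins (del_vert w) u v"
      using no_deletion \<open>w \<in> verts D\<close> unfolding point_determining_def by blast
    then have uv: "u \<in> verts D" "v \<in> verts D" "u \<noteq> v"
      and agree: "\<forall>x \<in> verts D - {w}. neighbourhood D u x = neighbourhood D v x"
      by (auto simp: false_twins_iff[OF loopfree_del] neighbourhood_def dominates_del_vert_iff
          verts_del_vert)
    \<comment> \<open>As \<open>u\<close> and \<open>v\<close> are not false twins in
      \<open>D\<close>, they differ at some vertex, and \<open>agree\<close> leaves only
      \<open>w\<close>.\<close>
    then have "neighbourhood D u w \<noteq> neighbourhood D v w"
      using \<open>point_determining D\<close>
      unfolding point_determining_def false_twins_iff[OF loopfree] by blast
    with uv agree show ?thesis by blast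
  qed
  \<comment> \<open>The vertices serve both as points and as coordinates: \<open>V\<close> and
    \<open>X\<close> are \<open>verts D\<close>, and \<open>f\<close> is
    \<open>neighbourhood D\<close>.\<close>
  have "card (verts D) < card (verts D)"
    using finite_verts \<open>verts D \<noteq> {}\<close> finite_verts critical
    by (rule card_less_if_all_coordinates_critical)
  then show False by simp
qed

end
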